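(* Let $D\subseteq\mathbb{R}^d$ be open, let $f:D\to\mathbb{R}^d$ be locally Lipschitz, let $x^*\in D$ be an equilibrium of $\dot x=f(x)$, and let $S\subseteq D$ be a compact set with $x^*\in\mathrm{int}(S)$. If, for some $\tau>0$, $V:D\to\mathbb{R}_{\ge 0}$ is a Recurrent Lyapunov Function (RLF) over $S$, then the equilibrium $x^*$ is stable.
   Context: $\|\cdot\|$ is an arbitrary fixed norm on $\mathbb{R}^d$. Locally Lipschitz means: for every compact $K\subset D$ there is $\overline L_K\ge 0$ with $\|f(y)-f(x)\|\le \overline L_K\|y-x\|$ for all $x,y\in K$. For $x\in D$, $\phi(t,x)$ is the solution of $\dot x=f(x)$ with $\phi(0,x)=x$, defined on its maximal open interval of existence $I(x)\ni 0$. An assertion about $\phi(t,x)$ for all $t\ge0$ includes that the solution exists for all $t\ge 0$. Containment times: $T_S(x;\tau):=\{t\in(0,\tau]: \phi(t,x)\in S\}$ (with $t\in I(x)$). An inequality $\min_{s\in T_S(x;\tau)}g(s)\le c$ (resp. $<c$) means that there is $s\in T_S(x;\tau)$ with $g(s)\le c$ (resp. $<c$); in particular $T_S(x;\tau)\neq\emptyset$. RLF: a continuous function $V:D\to\mathbb{R}_{\ge0}$ is a Recurrent Lyapunov Function over $S$ (for given $\tau>0$) if (i) $V(x^* )=0$ and $V(x)>0$ for all $x\in D\setminus\{x^*\}$; (ii) $\min_{s\in T_S(x;\tau)}V(\phi(s,x))\le V(x)$ for all $x\in S$. Stable: for every $\varepsilon>0$ there is $\delta>0$ such that $\|x-x^*\|\le\delta$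 implies $\|\phi(t,x)-x^*\|\le\varepsilon$ for all $t\ge0$. *)

theory Defs
  imports "HOL-Analysis.Analysis"
begin

text \<open>
  The norm is a parameter \<open>N\<close>, since the one of type \<open>real ^ 'n\<close> is Euclidean; topological notions
  (open, compact, interior, continuity, derivative) do not depend on the norm and are the library's.
\<close>

definition is_norm :: "(real ^ 'n \<Rightarrow> real) \<Rightarrow> bool" where
  "is_norm N \<longleftrightarrow>
     (\<forall>x. N x \<ge> 0) \<and>
     (\<forall>x. N x = 0 \<longleftrightarrow> x = 0) \<and>
     (\<forall>a x. N (a *\<^sub>R x) = \<bar>a\<bar> * N x) \<and>
     (\<forall>x y. N (x + y) \<le> N x + N y)"

definition locally_lipschitz ::
  "(real ^ 'n \<Rightarrow> real) \<Rightarrow> (real ^ 'n) set \<Rightarrow> (real ^ 'n \<Rightarrow> real ^ 'n) \<Rightarrow> bool" where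
  "locally_lipschitz N D f \<longleftrightarrow>
     (\<forall>K. compact K \<and> K \<subseteq> D \<longrightarrow> (\<exists>L\<ge>0. \<forall>x\<in>K. \<forall>y\<in>K. N (f y - f x) \<le> L * N (y - x)))"

text \<open>Values of \<open>f\<close> outside \<open>D\<close> are irrelevant, because solutions are required to stay in \<open>D\<close>.\<close>

definition ivp_solution ::
  "(real ^ 'n) set \<Rightarrow> (real ^ 'n \<Rightarrow> real ^ 'n) \<Rightarrow> real ^ 'n \<Rightarrow> real set \<Rightarrow> (real \<Rightarrow> real ^ 'n) \<Rightarrow> bool" where
  "ivp_solution D f x J u \<longleftrightarrow>
     open J \<and> is_interval J \<and> 0 \<in> J \<and> u 0 = x \<and>
     (\<forall>t\<in>J. u t \<in> D \<and> (u has_vector_derivative f (u t)) (at t))"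

definition max_interval ::
  "(real ^ 'n) set \<Rightarrow> (real ^ 'n \<Rightarrow> real ^ 'n) \<Rightarrow> real ^ 'n \<Rightarrow> real set" where
  "max_interval D f x = \<Union> {J. \<exists>u. ivp_solution D f x J u}"

text \<open>
  For \<open>f\<close> locally Lipschitz on the open set \<open>D\<close>, any two solutions agree on their common interval,
  so the description below is proper for every \<open>t \<in> max_interval D f x\<close>.
  For other \<open>t\<close> the value is unspecified, hence the explicit membership conditions further down.
\<close>

definition flow ::
  "(real ^ 'n) set \<Rightarrow> (real ^ 'n \<Rightarrow> real ^ 'n) \<Rightarrow> real \<Rightarrow> real ^ 'n \<Rightarrow> real ^ 'n" where
  "flow D f t x = (THE y. \<exists>J u. ivp_solution D f x J u \<and> t \<in> J \<and> u t = y)"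

definition containment_times ::
  "(real ^ 'n) set \<Rightarrow> (real ^ 'n \<Rightarrow> real ^ 'n) \<Rightarrow> (real ^ 'n) set \<Rightarrow> real ^ 'n \<Rightarrow> real \<Rightarrow> real set" where
  "containment_times D f S x \<tau> =
     {t. 0 < t \<and> t \<le> \<tau> \<and> t \<in> max_interval D f x \<and> flow D f t x \<in> S}"

definition recurrent_lyapunov_function ::
  "(real ^ 'n) set \<Rightarrow> (real ^ 'n \<Rightarrow> real ^ 'n) \<Rightarrow> real ^ 'n \<Rightarrow> (real ^ 'n) set \<Rightarrow> real \<Rightarrow>
     (real ^ 'n \<Rightarrow> real) \<Rightarrow> bool" where
  "recurrent_lyapunov_function D f xs S \<tau> V \<longleftrightarrow>
     continuous_on D V \<and> (\<forall>x\<in>D. V x \<ge> 0) \<and>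
     V xs = 0 \<and> (\<forall>x\<in>D - {xs}. V x > 0) \<and>
     (\<forall>x\<in>S. \<exists>s\<in>containment_times D f S x \<tau>. V (flow D f s x) \<le> V x)"

definition stable_equilibrium ::
  "(real ^ 'n \<Rightarrow> real) \<Rightarrow> (real ^ 'n) set \<Rightarrow> (real ^ 'n \<Rightarrow> real ^ 'n) \<Rightarrow> real ^ 'n \<Rightarrow> bool" where
  "stable_equilibrium N D f xs \<longleftrightarrow>
     (\<forall>\<epsilon>>0. \<exists>\<delta>>0. \<forall>x. N (x - xs) \<le> \<delta> \<longrightarrow>
        (\<forall>t\<ge>0. t \<in> max_interval D f x \<and> N (flow D f t x - xs) \<le> \<epsilon>))"

end

theory Submission
  imports Defs
begin

text \<open>
  Choose \<open>\<rho>\<close> with \<open>cball xs \<rho>\<close> inside \<open>D\<close> and inside the \<open>\<epsilon>\<close>-ball of \<open>N\<close>. By Gronwall, solutions that start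
  in \<open>ball xs r\<close>, \<open>r = \<rho> exp (- L \<tau>)\<close>, stay in \<open>ball xs \<rho>\<close> for time \<open>\<tau>\<close>. As \<open>V\<close> is bounded below by some
  \<open>m > 0\<close> on \<open>S - ball xs r\<close>, a starting point \<open>x\<close> close to \<open>xs\<close> has \<open>V x < m\<close>, so whenever its trajectory
  is in \<open>S\<close> with \<open>V\<close> at most \<open>V x\<close> it is in \<open>ball xs r\<close>. The set of these times is closed and, by
  recurrence, each of them is followed by another one within time \<open>\<tau>\<close>; taking suprema (return times may
  accumulate), every time is within \<open>\<tau>\<close> after one of them, so the trajectory never leaves \<open>ball xs \<rho>\<close>.

  Global existence is not an issue if one works with \<open>f\<close> composed with the nearest-point projection
  onto \<open>cball xs \<rho>\<close>, which is globally Lipschitz: its solutions exist for all times and are solutions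
  for \<open>f\<close> as long as they stay in the ball.
\<close>

section \<open>Global existence for globally Lipschitz vector fields\<close>

text \<open>For \<open>t \<ge> 0\<close> the right-hand side has derivative
  \<open>M * exp (K * t)\<close>, which dominates \<open>norm (h t)\<close>, so the mean value
  inequality applies; negative times follow by reflection. The gained factor \<open>1 / K\<close> is
  what yields the contraction below.\<close>

lemma norm_antiderivative_le_exp:
  fixes F :: "real \<Rightarrow> 'a::real_normed_vector"
  assumes "K > 0" and F0: "F 0 = 0"
    and F': "\<And>t. (F has_vector_derivative h t) (at t)"
    and h: "\<And>t. norm (h t) \<le> M * exp (K * \<bar>t\<bar>)"
  shows "norm (F t) \<le> M / K * exp (K * \<bar>t\<bar>)"
proof -
  have "0 \<le> M" using h[of 0] order_trans[OF norm_ge_zero] by fastforce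
  have bound: "norm (G t) \<le> M / K * exp (K * t)"
    if "t \<ge> 0" and G0: "G 0 = 0" and G': "\<And>t. (G has_vector_derivative k t) (at t)"
      and k: "\<And>t. norm (k t) \<le> M * exp (K * \<bar>t\<bar>)" for G k and t :: real
  proof (cases "t = 0")
    case True
    then show ?thesis using G0 \<open>0 \<le> M\<close> \<open>K > 0\<close> by simp
  next
    case False
    let ?\<phi> = "\<lambda>s. M / K * exp (K * s)"
    have "norm (G t - G 0) \<le> ?\<phi> t - ?\<phi> 0"
    proof (rule differentiable_bound_general)
      show "0 < t" using False \<open>t \<ge> 0\<close> by simp
      show "continuous_on {0..t} G"
        using G' by (meson continuous_at_imp_continuous_on has_vector_derivative_continuous)
      show "(G has_vector_derivative k s) (at s)" for s by (rule G')
      show "continuous_on {0..t} ?\<phi>" by (intro continuous_intros)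
      show "(?\<phi> has_vector_derivative M * exp (K * s)) (at s)" for s
        unfolding has_real_derivative_iff_has_vector_derivative[symmetric]
        using \<open>K > 0\<close> by (auto intro!: derivative_eq_intros)
      show "norm (k s) \<le> M * exp (K * s)" if "0 < s" for s using k[of s] that by simp
    qed
    then have "norm (G t) \<le> ?\<phi> t - ?\<phi> 0" by (simp add: G0)
    moreover have "?\<phi> 0 \<ge> 0" using \<open>0 \<le> M\<close> \<open>K > 0\<close> by simp
    ultimately show ?thesis by linarith
  qed
  show ?thesis
  proof (cases "t \<ge> 0")
    case True
    then show ?thesis using bound[OF True F0 F' h] by simp
  next
    case False
    have "((F \<circ> uminus) has_vector_derivative - 1 *\<^sub>R h (- s)) (at s)" for s
      by (rule vector_diff_chain_at) (auto intro!: derivative_eq_intros F')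
    then have "((\<lambda>s. F (- s)) has_vector_derivative - h (- s)) (at s)" for s
      by (simp add: o_def)
    from bound[of "- t" "\<lambda>s. F (- s)", OF _ _ this] show ?thesis
      using False F0 h by (metis abs_minus_cancel abs_of_neg add.inverse_inverse linorder_not_less
          minus_zero neg_0_le_iff_le nle_le norm_minus_cancel)
  qed
qed

text \<open>The fundamental theorem of calculus gives a derivative within a compact interval;
  enlarging that interval by 1 beyond both \<open>0\<close> and \<open>t\<close> puts
  \<open>t\<close> in its interior, so the derivative is two-sided.\<close>

lemma interval_integral_has_vector_derivative:
  fixes h :: "real \<Rightarrow> 'a::euclidean_space"
  assumes "continuous_on UNIV h"
  shows "((\<lambda>t. LBINT s=0..t. h s) has_vector_derivative h t) (at t)"
proof -
  let ?a = "min 0 t - 1" and ?b = "max 0 t + 1"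
  have "((\<lambda>u. LBINT s=ereal 0..u. h s) has_vector_derivative h t) (at t within {?a..?b})"
    by (rule interval_integral_FTC2) (auto intro: continuous_on_subset[OF assms])
  moreover have "t \<in> interior {?a..?b}" by auto
  ultimately show ?thesis by (simp only: at_within_interior zero_ereal_def)
qed

theorem global_solution_exists:
  fixes g :: "'a::euclidean_space \<Rightarrow> 'a"
  assumes lip: "L-lipschitz_on UNIV g"
  obtains u where "u 0 = x" "\<And>t. (u has_vector_derivative g (u t)) (at t)"
proof -
  \<comment> \<open>Adding 1 keeps the constants positive even if \<open>L = 0\<close>; the factor 2
    in \<open>K\<close> makes the contraction factor \<open>L' / K\<close> equal to
    \<open>1/2\<close>.\<close>
  define L' where "L' = L + 1"
  define K where "K = 2 * L'"
  have "L \<ge> 0" using lip by (rule lipschitz_on_nonneg)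
  then have "L' > 0" and "K > 0" by (auto simp: L'_def K_def)
  have g: "norm (g y - g z) \<le> L' * norm (y - z)" for y z
    using lipschitz_on_normD[OF lip, of y z] mult_right_mono[of L L' "norm (y - z)"]
    by (simp add: L'_def)
  have cont_g: "continuous_on UNIV g" using lip by (rule lipschitz_on_continuous_on)
  \<comment> \<open>Substituting \<open>u t = x + exp (K * \<bar>t\<bar>) *\<^sub>R v t\<close> makes the Picard operator a contraction for the
    sup norm on the whole line.\<close>
  define R where "R v s = x + exp (K * \<bar>s\<bar>) *\<^sub>R apply_bcontfun v s" for v :: "real \<Rightarrow>\<^sub>C 'a" and s
  define F where "F v t = (LBINT s=0..t. g (R v s))" for v and t :: real
  define T where "T v t = exp (- K * \<bar>t\<bar>) *\<^sub>R F v t" for v t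
  have cont_R: "continuous_on UNIV (R v)" for v
    unfolding R_def by (intro continuous_intros) auto
  have F': "(F v has_vector_derivative g (R v t)) (at t)" for v t
    unfolding F_def
    by (rule interval_integral_has_vector_derivative)
      (intro continuous_on_compose2[OF cont_g cont_R], simp)
  have F0: "F v 0 = 0" for v by (simp add: F_def zero_ereal_def)
  have scale: "norm (exp (- K * \<bar>t\<bar>) *\<^sub>R y) \<le> M" if "norm y \<le> M * exp (K * \<bar>t\<bar>)" for t M and y :: 'a
    using mult_left_mono[OF that, of "exp (- K * \<bar>t\<bar>)"] by (simp add: exp_minus field_simps)
  have T_bcontfun: "T v \<in> bcontfun" for v
  proof (rule bcontfun_normI)
    show "continuous_on UNIV (T v)"
      unfolding T_def
      by (intro continuous_intros continuous_at_imp_continuous_on ballI)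
        (rule has_vector_derivative_continuous[OF F'])
    show "norm (T v t) \<le> (norm (g x) + L' * norm v) / K" for t
      unfolding T_def
    proof (rule scale, rule norm_antiderivative_le_exp[OF \<open>K > 0\<close> F0 F'])
      fix t
      have "norm (g (R v t)) \<le> norm (g x) + norm (g (R v t) - g x)" by norm
      also have "\<dots> \<le> norm (g x) + L' * (exp (K * \<bar>t\<bar>) * norm (apply_bcontfun v t))"
        using g[of "R v t" x] by (simp add: R_def)
      also have "\<dots> \<le> norm (g x) * exp (K * \<bar>t\<bar>) + L' * (exp (K * \<bar>t\<bar>) * norm v)"
        using \<open>K > 0\<close> \<open>L' > 0\<close>
        by (intro add_mono mult_left_mono norm_bounded) (auto simp: mult_le_cancel_left1)
      finally show "norm (g (R v t)) \<le> (norm (g x) + L' * norm v) * exp (K * \<bar>t\<bar>)"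
        by (simp add: algebra_simps)
    qed
  qed
  have T_contraction: "dist (Bcontfun (T v)) (Bcontfun (T w)) \<le> 1/2 * dist v w" for v w
  proof (rule dist_bound)
    fix t
    have "norm (exp (- K * \<bar>t\<bar>) *\<^sub>R (F v t - F w t)) \<le> L' * dist v w / K"
    proof (rule scale, rule norm_antiderivative_le_exp[OF \<open>K > 0\<close>])
      show "F v 0 - F w 0 = 0" by (simp add: F0)
      show "((\<lambda>t. F v t - F w t) has_vector_derivative g (R v s) - g (R w s)) (at s)" for s
        by (intro has_vector_derivative_diff F')
      fix s
      have "R v s - R w s = exp (K * \<bar>s\<bar>) *\<^sub>R (apply_bcontfun v s - apply_bcontfun w s)"
        by (simp add: R_def algebra_simps)
      then have "norm (g (R v s) - g (R w s)) \<le> L' * (exp (K * \<bar>s\<bar>) * dist (apply_bcontfun v s) (apply_bcontfun w s))"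
        using g[of "R v s" "R w s"] by (simp add: dist_norm)
      also have "\<dots> \<le> L' * (exp (K * \<bar>s\<bar>) * dist v w)"
        using \<open>L' > 0\<close> by (intro mult_left_mono dist_bounded) auto
      finally show "norm (g (R v s) - g (R w s)) \<le> L' * dist v w * exp (K * \<bar>s\<bar>)"
        by (simp add: algebra_simps)
    qed
    moreover have "L' * dist v w / K = 1/2 * dist v w" using \<open>L' > 0\<close> by (simp add: K_def)
    ultimately show "dist (apply_bcontfun (Bcontfun (T v)) t) (apply_bcontfun (Bcontfun (T w)) t) \<le> 1/2 * dist v w"
      by (simp add: Bcontfun_inverse T_bcontfun dist_norm[where 'a = 'a] T_def scaleR_diff_right)
  qed
  have "\<exists>!v. Bcontfun (T v) = v"
    by (rule banach_fix_type[of "1/2"]) (use T_contraction in auto)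
  then obtain v where v: "Bcontfun (T v) = v" by blast
  have "apply_bcontfun v = T v"
    using Bcontfun_inverse[OF T_bcontfun[of v]] v by simp
  \<comment> \<open>Undoing the exponential weight turns the fixed point equation into the Picard
    integral equation for \<open>R v\<close>.\<close>
  then have R_eq: "R v t = x + F v t" for t
    by (simp add: R_def T_def exp_minus)
  show ?thesis
  proof
    show "x + F v 0 = x" by (simp add: F0)
    show "((\<lambda>t. x + F v t) has_vector_derivative g (x + F v t)) (at t)" for t
      using F'[of v t] by (auto intro!: derivative_eq_intros simp: R_eq)
  qed
qed

section \<open>Gronwall estimate and change of norm\<close>

text \<open>By Cauchy-Schwarz, the squared distance weighted by \<open>exp (- 2 * L * t)\<close> has
  nonpositive derivative; squaring avoids the point where the norm is not differentiable. The
  Lipschitz bound is asked only along the two curves, so a bound on a compact set containing them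
  suffices.\<close>

lemma solutions_dist_le_exp:
  fixes u v :: "real \<Rightarrow> 'a::real_inner"
  assumes "a \<le> b"
    and u: "\<And>t. t \<in> {a..b} \<Longrightarrow> (u has_vector_derivative u' t) (at t)"
    and v: "\<And>t. t \<in> {a..b} \<Longrightarrow> (v has_vector_derivative v' t) (at t)"
    and lip: "\<And>t. t \<in> {a..b} \<Longrightarrow> norm (u' t - v' t) \<le> L * norm (u t - v t)"
  shows "norm (u b - v b) \<le> exp (L * (b - a)) * norm (u a - v a)"
proof -
  define w where "w t = exp (- 2 * L * t) * ((u t - v t) \<bullet> (u t - v t))" for t
  have "w b \<le> w a"
  proof (rule DERIV_nonpos_imp_nonincreasing[OF \<open>a \<le> b\<close>])
    fix t assume "a \<le> t" "t \<le> b"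
    then have t: "t \<in> {a..b}" by simp
    let ?d = "u t - v t" and ?d' = "u' t - v' t"
    have "((\<lambda>t. u t - v t) has_derivative (\<lambda>s. s *\<^sub>R ?d')) (at t)"
      using has_vector_derivative_diff[OF u[OF t] v[OF t]] by (simp add: has_vector_derivative_def)
    from has_derivative_inner[OF this this]
    have "((\<lambda>t. (u t - v t) \<bullet> (u t - v t)) has_real_derivative 2 * (?d \<bullet> ?d')) (at t)"
      unfolding has_field_derivative_def
      by (rule has_derivative_eq_rhs) (auto simp: fun_eq_iff inner_commute algebra_simps)
    then have "(w has_real_derivative
        exp (- 2 * L * t) * (2 * (?d \<bullet> ?d')) - 2 * L * exp (- 2 * L * t) * (?d \<bullet> ?d)) (at t)"
      unfolding w_def by (auto intro!: derivative_eq_intros)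
    moreover have "?d \<bullet> ?d' \<le> L * (?d \<bullet> ?d)"
    proof -
      have "?d \<bullet> ?d' \<le> norm ?d * norm ?d'" by (rule norm_cauchy_schwarz)
      also have "\<dots> \<le> norm ?d * (L * norm ?d)" using lip[OF t] by (intro mult_left_mono) auto
      finally show ?thesis by (simp add: dot_square_norm power2_eq_square algebra_simps)
    qed
    from mult_left_mono[OF this, of "2 * exp (- 2 * L * t)"]
    have "exp (- 2 * L * t) * (2 * (?d \<bullet> ?d')) - 2 * L * exp (- 2 * L * t) * (?d \<bullet> ?d) \<le> 0"
      by (simp only: mult_ac) simp
    ultimately show "\<exists>y. (w has_real_derivative y) (at t) \<and> y \<le> 0" by blast
  qed
  then have "(exp (- L * b) * norm (u b - v b))\<^sup>2 \<le> (exp (- L * a) * norm (u a - v a))\<^sup>2"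
    by (simp add: w_def power_mult_distrib dot_square_norm exp_double[symmetric] mult.assoc)
  then have "exp (- L * b) * norm (u b - v b) \<le> exp (- L * a) * norm (u a - v a)"
    by (rule power2_le_imp_le) simp
  then show ?thesis by (simp add: exp_minus exp_diff field_simps)
qed

text \<open>Expanding in the standard basis gives the upper bound. It makes \<open>N\<close>
  Lipschitz, hence continuous, so \<open>N\<close> attains a positive minimum on the Euclidean unit
  sphere, and scaling gives the lower bound.\<close>

lemma is_norm_equivalent:
  fixes N :: "real ^ 'n \<Rightarrow> real"
  assumes "is_norm N"
  obtains c C where "c > 0" "C > 0" "\<And>x. c * norm x \<le> N x" "\<And>x. N x \<le> C * norm x"
proof -
  have nonneg: "N x \<ge> 0" and zero: "N x = 0 \<longleftrightarrow> x = 0" and scale: "N (a *\<^sub>R x) = \<bar>a\<bar> * N x"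
    and tri: "N (x + y) \<le> N x + N y" for x y a
    using assms by (auto simp: is_norm_def)
  have sum: "N (sum h A) \<le> (\<Sum>i\<in>A. N (h i))" if "finite A" for h :: "real ^ 'n \<Rightarrow> real ^ 'n" and A
    using that
  proof (induction A)
    case empty
    then show ?case using zero[of 0] by simp
  next
    case (insert i A)
    then show ?case using tri[of "h i" "sum h A"] by simp
  qed
  \<comment> \<open>The summand 1 gives \<open>C > 0\<close> from nonnegativity of \<open>N\<close>
    alone.\<close>
  define C where "C = (\<Sum>b\<in>Basis. N b) + 1"
  have "C > 0" unfolding C_def by (intro add_nonneg_pos sum_nonneg nonneg) simp
  have upper: "N x \<le> C * norm x" for x
  proof -
    have "N x = N (\<Sum>b\<in>Basis. (x \<bullet> b) *\<^sub>R b)" by (simp add: euclidean_representation)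
    also have "\<dots> \<le> (\<Sum>b\<in>Basis. \<bar>x \<bullet> b\<bar> * N b)" using sum[OF finite_Basis, of "\<lambda>b. (x \<bullet> b) *\<^sub>R b"] by (simp add: scale)
    also have "\<dots> \<le> (\<Sum>b\<in>Basis. norm x * N b)"
      by (intro sum_mono mult_right_mono nonneg Basis_le_norm)
    also have "\<dots> \<le> C * norm x" by (simp add: C_def sum_distrib_left algebra_simps)
    finally show ?thesis .
  qed
  have "C-lipschitz_on UNIV N"
  proof (rule lipschitz_onI)
    fix x y
    have "N x \<le> N y + N (x - y)" "N y \<le> N x + N (y - x)"
      using tri[of y "x - y"] tri[of x "y - x"] by auto
    then show "dist (N x) (N y) \<le> C * dist x y"
      using upper[of "x - y"] upper[of "y - x"] by (auto simp: dist_norm norm_minus_commute)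
  qed (use \<open>C > 0\<close> in simp)
  then have "continuous_on (sphere 0 1) N"
    by (meson lipschitz_on_continuous_on continuous_on_subset subset_UNIV)
  moreover have "axis undefined 1 \<in> sphere (0 :: real ^ 'n) 1" by simp
  then have "sphere (0 :: real ^ 'n) 1 \<noteq> {}" by blast
  ultimately obtain z where z: "z \<in> sphere 0 1" "\<And>y. y \<in> sphere 0 1 \<Longrightarrow> N z \<le> N y"
    using continuous_attains_inf[OF compact_sphere] by metis
  have "N z \<noteq> 0" using z(1) zero[of z] by auto
  then have "N z > 0" using nonneg[of z] by simp
  have lower: "N z * norm x \<le> N x" for x
  proof (cases "x = 0")
    case False
    then have "N z \<le> N (inverse (norm x) *\<^sub>R x)" by (intro z(2)) simp
    then show ?thesis using False by (simp add: scale field_simps)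
  qed (simp add: nonneg)
  show ?thesis using that \<open>N z > 0\<close> \<open>C > 0\<close> upper lower by blast
qed

text \<open>Norm equivalence changes the constant \<open>L\<close> into \<open>L * C / c\<close>.
  This moves the hypothesis on \<open>f\<close> to the Euclidean norm, where the inner product
  estimate applies.\<close>

lemma locally_lipschitz_imp_lipschitz_on:
  assumes "is_norm N" and "locally_lipschitz N D f" and "compact K" and "K \<subseteq> D"
  obtains L where "L-lipschitz_on K f"
proof -
  obtain c C where c: "c > 0" "C > 0" "\<And>x. c * norm x \<le> N x" "\<And>x. N x \<le> C * norm x"
    using is_norm_equivalent[OF assms(1)] by metis
  obtain L where L: "L \<ge> 0" "\<And>x y. x \<in> K \<Longrightarrow> y \<in> K \<Longrightarrow> N (f y - f x) \<le> L * N (y - x)"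
    using assms(2-4) unfolding locally_lipschitz_def by metis
  have "(L * C / c)-lipschitz_on K f"
  proof (rule lipschitz_onI)
    fix x y assume xy: "x \<in> K" "y \<in> K"
    have "c * norm (f x - f y) \<le> N (f x - f y)" by (rule c)
    also have "\<dots> \<le> L * N (x - y)" using L(2) xy by simp
    also have "\<dots> \<le> L * (C * norm (x - y))" using c(4) L(1) by (intro mult_left_mono)
    finally show "dist (f x) (f y) \<le> L * C / c * dist x y"
      using c(1) by (simp add: dist_norm field_simps)
  qed (use L(1) c in simp)
  then show ?thesis using that by blast
qed

section \<open>Uniqueness and identification of the flow\<close>

text \<open>Both curves trace compact subsets of \<open>D\<close> over \<open>{0..t}\<close>, so
  \<open>f\<close> is Lipschitz on their union, and the Gronwall estimate with equal initial values
  forces equality.\<close>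

lemma ivp_solution_unique:
  assumes "is_norm N" and "locally_lipschitz N D f"
    and u: "ivp_solution D f x I u" and v: "ivp_solution D f x J v"
    and "t \<ge> 0" "t \<in> I" "t \<in> J"
  shows "u t = v t"
proof -
  have sub: "{0..t} \<subseteq> I" "{0..t} \<subseteq> J"
    using u v assms(5-7) unfolding ivp_solution_def is_interval_1 by (metis atLeastAtMost_iff subsetI)+
  let ?K = "u ` {0..t} \<union> v ` {0..t}"
  have u': "(u has_vector_derivative f (u s)) (at s)" and v': "(v has_vector_derivative f (v s)) (at s)"
    and D: "u s \<in> D" "v s \<in> D" if "s \<in> {0..t}" for s
    using u v sub that unfolding ivp_solution_def by blast+
  have "continuous_on {0..t} u" "continuous_on {0..t} v"
    using u' v' by (meson continuous_at_imp_continuous_on has_vector_derivative_continuous)+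
  then have "compact ?K" by (intro compact_Un compact_continuous_image) auto
  moreover have "?K \<subseteq> D" using D by auto
  ultimately obtain L where L: "L-lipschitz_on ?K f"
    using locally_lipschitz_imp_lipschitz_on[OF assms(1,2)] by metis
  have "norm (u t - v t) \<le> exp (L * (t - 0)) * norm (u 0 - v 0)"
    using \<open>t \<ge> 0\<close> u' v' lipschitz_on_normD[OF L] by (intro solutions_dist_le_exp) auto
  then show ?thesis using u v by (simp add: ivp_solution_def)
qed

lemma flow_eq_ivp_solution:
  assumes "is_norm N" and "locally_lipschitz N D f" and "ivp_solution D f x J u" and "t \<ge> 0" "t \<in> J"
  shows "flow D f t x = u t"
  unfolding flow_def
proof (rule the_equality)
  show "\<exists>J v. ivp_solution D f x J v \<and> t \<in> J \<and> v t = u t" using assms(3,5) by blast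
  show "y = u t" if "\<exists>J v. ivp_solution D f x J v \<and> t \<in> J \<and> v t = y" for y
    using that ivp_solution_unique[OF assms(1,2) _ assms(3,4) _ assms(5)] by metis
qed

text \<open>This leads from the modified field \<open>g\<close> back to the flow of
  \<open>f\<close>: while \<open>u\<close> is in \<open>B\<close> it solves the equation for
  \<open>f\<close>, and by autonomy it may be shifted to start at time \<open>a\<close>.\<close>

lemma flow_eq_global_solution:
  assumes "is_norm N" and "locally_lipschitz N D f" and "open B" and "B \<subseteq> D"
    and fg: "\<And>y. y \<in> B \<Longrightarrow> g y = f y"
    and u: "\<And>t. (u has_vector_derivative g (u t)) (at t)"
    and "a \<le> b" and B: "\<And>t. t \<in> {a..b} \<Longrightarrow> u t \<in> B"
  shows "b - a \<in> max_interval D f (u a)" and "flow D f (b - a) (u a) = u b"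
proof -
  have "continuous_on UNIV u"
    using u by (meson continuous_at_imp_continuous_on has_vector_derivative_continuous)
  then have "open (u -` B)" using \<open>open B\<close> by (simp add: open_vimage)
  moreover have "a \<in> u -` B" "b \<in> u -` B" using B \<open>a \<le> b\<close> by auto
  ultimately obtain d e where de: "d > 0" "ball a d \<subseteq> u -` B" "e > 0" "ball b e \<subseteq> u -` B"
    unfolding open_contains_ball by metis
  \<comment> \<open>Solutions live on open intervals, so \<open>{0..b - a}\<close> is widened at
    both ends by margins over which \<open>u\<close> is still in the open set
    \<open>B\<close>.\<close>
  let ?J = "{- d<..<b - a + e}"
  have in_B: "u (a + t) \<in> B" if "t \<in> ?J" for t
  proof -
    consider "a + t < a" | "a + t \<in> {a..b}" | "b < a + t" by fastforce
    then show ?thesis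
    proof cases
      case 1
      then have "a + t \<in> ball a d" using that by (simp add: dist_real_def)
      then show ?thesis using de(2) by auto
    next
      case 3
      then have "a + t \<in> ball b e" using that by (simp add: dist_real_def)
      then show ?thesis using de(4) by auto
    qed (rule B)
  qed
  have "((u \<circ> (+) a) has_vector_derivative 1 *\<^sub>R g (u (a + t))) (at t)" for t
    by (rule vector_diff_chain_at) (auto intro!: derivative_eq_intros u)
  then have "((\<lambda>t. u (a + t)) has_vector_derivative f (u (a + t))) (at t)" if "t \<in> ?J" for t
    using fg[OF in_B[OF that]] by (metis comp_apply ext scaleR_one)
  then have sol: "ivp_solution D f (u a) ?J (\<lambda>t. u (a + t))"
    unfolding ivp_solution_def using in_B \<open>B \<subseteq> D\<close> \<open>a \<le> b\<close> de by auto
  have "b - a \<in> ?J" using de \<open>a \<le> b\<close> by simp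
  then show "b - a \<in> max_interval D f (u a)" using sol unfolding max_interval_def by blast
  show "flow D f (b - a) (u a) = u b"
    using flow_eq_ivp_solution[OF assms(1,2) sol _ \<open>b - a \<in> ?J\<close>] \<open>a \<le> b\<close> by simp
qed

section \<open>Recurrence and stability\<close>

text \<open>By compactness \<open>G\<close> has a last element in \<open>{0..T}\<close>. Were it
  more than \<open>\<tau>\<close> before \<open>T\<close>, its successor would be a later element in
  \<open>{0..T}\<close>. Iterating \<open>step\<close> instead might never reach
  \<open>T\<close>.\<close>

lemma closed_set_gaps_le:
  fixes G :: "real set"
  assumes "closed G" "0 \<in> G" "T \<ge> 0"
    and step: "\<And>t. t \<in> G \<Longrightarrow> t \<ge> 0 \<Longrightarrow> \<exists>s. 0 < s \<and> s \<le> \<tau> \<and> t + s \<in> G"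
  shows "\<exists>t\<in>G. 0 \<le> t \<and> t \<le> T \<and> T \<le> t + \<tau>"
proof -
  let ?A = "G \<inter> {0..T}"
  have "compact ?A" using \<open>closed G\<close> by (simp add: closed_Int_compact)
  moreover have "?A \<noteq> {}" using assms by auto
  ultimately obtain t where t: "t \<in> ?A" "\<And>s. s \<in> ?A \<Longrightarrow> s \<le> t"
    using compact_attains_sup by metis
  moreover have "T \<le> t + \<tau>"
  proof (rule ccontr)
    assume "\<not> T \<le> t + \<tau>"
    moreover obtain s where "0 < s" "s \<le> \<tau>" "t + s \<in> G" using step t(1) by auto
    ultimately show False using t(2)[of "t + s"] t(1) by auto
  qed
  ultimately show ?thesis by auto
qed

theorem theorem1:
  fixes N :: "real ^ 'n \<Rightarrow> real"
    and D S :: "(real ^ 'n) set"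
    and f :: "real ^ 'n \<Rightarrow> real ^ 'n"
    and xs :: "real ^ 'n"
    and V :: "real ^ 'n \<Rightarrow> real"
    and \<tau> :: real
  assumes "is_norm N"
    and "open D"
    and "locally_lipschitz N D f"
    and "xs \<in> D" and "f xs = 0"
    and "compact S" and "S \<subseteq> D" and "xs \<in> interior S"
    and "\<tau> > 0"
    and "recurrent_lyapunov_function D f xs S \<tau> V"
  shows "stable_equilibrium N D f xs"
  unfolding stable_equilibrium_def
proof (intro allI impI)
  fix \<epsilon> :: real assume "\<epsilon> > 0"
  obtain c C where c: "c > 0" "C > 0" "\<And>x. c * norm x \<le> N x" "\<And>x. N x \<le> C * norm x"
    using is_norm_equivalent[OF assms(1)] by metis
  have V: "continuous_on D V" "V xs = 0" "\<And>x. x \<in> D - {xs} \<Longrightarrow> V x > 0"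
    "\<And>x. x \<in> S \<Longrightarrow> \<exists>s\<in>containment_times D f S x \<tau>. V (flow D f s x) \<le> V x"
    using assms(10) by (auto simp: recurrent_lyapunov_function_def)
  obtain \<rho>0 where \<rho>0: "\<rho>0 > 0" "cball xs \<rho>0 \<subseteq> D"
    using assms(2,4) open_contains_cball by metis
  define \<rho> where "\<rho> = min \<rho>0 (\<epsilon> / C)"
  have "cball xs \<rho> \<subseteq> cball xs \<rho>0" by (rule subset_cball) (simp add: \<rho>_def)
  then have \<rho>: "\<rho> > 0" "cball xs \<rho> \<subseteq> D" "C * \<rho> \<le> \<epsilon>"
    using \<rho>0 \<open>\<epsilon> > 0\<close> c(2) by (auto simp: \<rho>_def min_def field_simps)
  obtain L where L: "L-lipschitz_on (cball xs \<rho>) f"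
    using locally_lipschitz_imp_lipschitz_on[OF assms(1,3) compact_cball \<rho>(2)] .
  have "L \<ge> 0" using L by (rule lipschitz_on_nonneg)
  define g where "g y = f (closest_point (cball xs \<rho>) y)" for y
  have fg: "g y = f y" if "y \<in> cball xs \<rho>" for y
    using that by (simp add: g_def closest_point_self)
  have cp: "closest_point (cball xs \<rho>) y \<in> cball xs \<rho>" for y
    using \<rho>(1) by (intro closest_point_in_set) auto
  have g: "L-lipschitz_on UNIV g"
  \<comment> \<open>Projection onto a closed convex set does not increase distances, so
    \<open>g\<close> inherits the constant \<open>L\<close>.\<close>
  proof (rule lipschitz_onI[OF _ \<open>L \<ge> 0\<close>])
    fix y z
    have "dist (g y) (g z) \<le> L * dist (closest_point (cball xs \<rho>) y) (closest_point (cball xs \<rho>) z)"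
      unfolding g_def by (rule lipschitz_onD[OF L cp cp])
    also have "\<dots> \<le> L * dist y z"
      using \<rho>(1) \<open>L \<ge> 0\<close> by (intro mult_left_mono closest_point_lipschitz) auto
    finally show "dist (g y) (g z) \<le> L * dist y z" .
  qed
  have "g xs = 0" using fg[of xs] \<rho>(1) assms(5) by simp
  define r where "r = \<rho> * exp (- L * \<tau>)"
  have "r > 0" using \<rho> by (simp add: r_def)
  have stay: "u t \<in> ball xs \<rho>"
    if u: "\<And>t. (u has_vector_derivative g (u t)) (at t)" and "u a \<in> ball xs r" "t \<in> {a..a + \<tau>}"
    for u a t
  proof -
    \<comment> \<open>The comparison curve is the equilibrium, a constant solution because
      \<open>g xs = 0\<close>.\<close>
    have "norm (u t - xs) \<le> exp (L * (t - a)) * norm (u a - xs)"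
      using that lipschitz_on_normD[OF g, of _ xs] \<open>g xs = 0\<close>
      by (intro solutions_dist_le_exp[where v = "\<lambda>_. xs" and u' = "\<lambda>t. g (u t)" and v' = "\<lambda>_. 0"]) auto
    also have "\<dots> \<le> exp (L * \<tau>) * norm (u a - xs)"
      using that(3) \<open>L \<ge> 0\<close> by (intro mult_right_mono) (auto intro: mult_left_mono)
    also have "\<dots> < exp (L * \<tau>) * r"
      using that(2) by (simp add: dist_norm norm_minus_commute)
    also have "\<dots> = \<rho>" by (simp add: r_def exp_minus)
    finally show ?thesis by (simp add: dist_norm norm_minus_commute)
  qed
  obtain m where m: "m > 0" "\<And>y. y \<in> S - ball xs r \<Longrightarrow> m \<le> V y"
  proof (cases "S - ball xs r = {}")
    case True
    \<comment> \<open>With nothing to bound, any positive value serves as \<open>m\<close>.\<close>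
    show ?thesis by (rule that[of 1]) (simp, use True in blast)
  next
    case False
    have "compact (S - ball xs r)" using assms(6) by (simp add: compact_diff)
    moreover have "continuous_on (S - ball xs r) V"
      using V(1) by (rule continuous_on_subset) (use assms(7) in auto)
    ultimately obtain z where z: "z \<in> S - ball xs r" "\<And>y. y \<in> S - ball xs r \<Longrightarrow> V z \<le> V y"
      using continuous_attains_inf False by metis
    \<comment> \<open>The minimizer \<open>z\<close> differs from \<open>xs\<close>, since it lies
      outside \<open>ball xs r\<close>.\<close>
    have "V z > 0" using z(1) assms(7) \<open>r > 0\<close> by (intro V(3)) auto
    then show ?thesis using that z(2) by blast
  qed
  have "continuous (at xs) V" using V(1) assms(2,4) continuous_on_eq_continuous_at by blast
  then obtain d1 where d1: "d1 > 0" "\<And>x. dist x xs < d1 \<Longrightarrow> dist (V x) (V xs) < m"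
    unfolding continuous_at_eps_delta using m(1) by metis
  obtain d2 where d2: "d2 > 0" "ball xs d2 \<subseteq> S"
    using assms(8) by (meson mem_interior)
  \<comment> \<open>The factor \<open>c\<close> converts from \<open>N\<close> to the Euclidean
    norm; halving turns the non-strict bound into a strict one.\<close>
  define \<delta> where "\<delta> = c * min d1 d2 / 2"
  have "\<delta> > 0" using c d1 d2 by (simp add: \<delta>_def)
  moreover have "T \<in> max_interval D f x \<and> N (flow D f T x - xs) \<le> \<epsilon>"
    if x: "N (x - xs) \<le> \<delta>" and "T \<ge> 0" for x T
  proof -
    have "c * norm (x - xs) \<le> c * (min d1 d2 / 2)" using c(3)[of "x - xs"] x by (simp add: \<delta>_def)
    then have "norm (x - xs) < min d1 d2" using c(1) d1 d2 by simp
    then have "x \<in> S" "V x < m"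
      using d1(2)[of x] d2(2) V(2) by (auto simp: dist_norm norm_minus_commute subset_iff)
    obtain u where u: "u 0 = x" "\<And>t. (u has_vector_derivative g (u t)) (at t)"
      using global_solution_exists[OF g] by metis
    note flow = flow_eq_global_solution[OF assms(1,3) open_ball, of xs \<rho> g u]
    \<comment> \<open>The level is fixed at the initial value \<open>V x\<close>, so that successive
      returns stay in \<open>G\<close> and \<open>G\<close> is closed.\<close>
    define G where "G = u -` {y \<in> S. V y \<le> V x}"
    have near: "u t \<in> ball xs \<rho>" if "t' \<in> G" "t' \<le> t" "t \<le> t' + \<tau>" for t t'
    proof -
      have "u t' \<in> ball xs r" using m(2)[of "u t'"] \<open>V x < m\<close> \<open>t' \<in> G\<close> by (fastforce simp: G_def)
      then show ?thesis using stay[OF u(2)] that by auto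
    qed
    have "\<exists>t\<in>G. 0 \<le> t \<and> t \<le> T' \<and> T' \<le> t + \<tau>" if "T' \<ge> 0" for T'
    proof (rule closed_set_gaps_le[OF _ _ that])
      have "continuous_on S V" using V(1) assms(7) by (rule continuous_on_subset)
      then have "closed {y \<in> S. V y \<le> V x}"
        using assms(6) by (intro continuous_on_closed_Collect_le) (auto simp: compact_imp_closed)
      moreover have "continuous_on UNIV u"
        using u(2) by (meson continuous_at_imp_continuous_on has_vector_derivative_continuous)
      ultimately show "closed G" unfolding G_def by (rule closed_vimage)
      show "0 \<in> G" using u(1) \<open>x \<in> S\<close> by (simp add: G_def)
      fix t assume t: "t \<in> G"
      then obtain s where s: "s \<in> containment_times D f S (u t) \<tau>" "V (flow D f s (u t)) \<le> V (u t)"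
        using V(4)[of "u t"] by (auto simp: G_def)
      then have s': "0 < s" "s \<le> \<tau>" "flow D f s (u t) \<in> S" by (auto simp: containment_times_def)
      \<comment> \<open>Recurrence concerns the flow of \<open>f\<close>; it agrees with
        \<open>u\<close> here because \<open>s \<le> \<tau>\<close> and \<open>near\<close> keeps
        \<open>u\<close> in the ball up to time \<open>t + s\<close>.\<close>
      have "flow D f (t + s - t) (u t) = u (t + s)"
        using \<rho>(2) fg u(2) s' near[OF t] by (intro flow(2)) auto
      then show "\<exists>s. 0 < s \<and> s \<le> \<tau> \<and> t + s \<in> G"
        using s s' t by (auto simp: G_def)
    qed
    then have ball: "u t \<in> ball xs \<rho>" if "t \<ge> 0" for t using near that by blast
    have "T - 0 \<in> max_interval D f (u 0)" "flow D f (T - 0) (u 0) = u T"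
      using \<rho>(2) fg u(2) ball \<open>T \<ge> 0\<close> by (intro flow; auto)+
    moreover have "N (u T - xs) \<le> \<epsilon>"
    proof -
      have "N (u T - xs) \<le> C * norm (u T - xs)" by (rule c)
      also have "\<dots> \<le> C * \<rho>"
        using ball[OF \<open>T \<ge> 0\<close>] c(2) by (intro mult_left_mono) (auto simp: dist_norm norm_minus_commute)
      finally show ?thesis using \<rho>(3) by simp
    qed
    ultimately show ?thesis by (simp add: u(1))
  qed
  ultimately show "\<exists>\<delta>>0. \<forall>x. N (x - xs) \<le> \<delta> \<longrightarrow>
      (\<forall>t\<ge>0. t \<in> max_interval D f x \<and> N (flow D f t x - xs) \<le> \<epsilon>)" by blast
qed

end
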